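(* Let $K(x)$, $x\in(0,\infty)^d$, be the Onsager response matrix described in the context, and let $|g|(x)=\dfrac{d}{\lambda_1(x)\cdots\lambda_{d-1}(x)}$ for $x\in(0,\infty)^d$, where $\lambda_1(x),\dots,\lambda_{d-1}(x)$ are the positive eigenvalues of $K(x)$. Let $f\in C^2((0,\infty)^d)$ and let $F(x^1,\dots,x^{d-1})=f(x^1,\dots,x^{d-1},1-x^1-\dots-x^{d-1})$ on $\Omega_{d-1}=\{x'\in(0,1)^{d-1}:0<\sum_{i=1}^{d-1}x^i<1\}$. For the Riemannian metric $g$ on the relative interior of the simplex $\mathcal S^\circ=\{x\in(0,1)^d:\sum_i x_i=1\}$ whose coordinate components in the coordinates $(x^1,\dots,x^{d-1})$ are $g_{ij}(x)=\langle e_i-e_d,K^\dagger(x)(e_j-e_d)\rangle_{\mathbb R^d}$ (with $K^\dagger$ the Moore–Penrose pseudoinverse), let $(g^{ij})$ be the inverse matrix and define the Laplace–Beltrami operator $\Delta_g f=\frac{1}{\sqrt{|g|}}\sum_{i,j=1}^{d-1}\frac{\partial}{\partial x^i}\big(\sqrt{|g|}\,g^{ij}\frac{\partial F}{\partial x^j}\big)$ and the Dirichlet energy density $g(\operatorname{grad}_g f,\operatorname{grad}_g f)=\sum_{i,j=1}^{d-1}g^{ij}\partial_iF\,\partial_jF$. Then at every point $x\in\mathcal S^\circ$, $$\Delta_g f=\frac{1}{\sqrt{|g|}}\nabla\cdot\big(\sqrt{|g|}\,K\nabla f\big),\qquad g(\operatorname{grad}_g f,\operatorname{grad}_g f)=\langle\nabla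 f,K\nabla f\rangle_{\mathbb R^d},$$ where $\nabla$ and $\nabla\cdot$ are the Euclidean gradient and divergence in $\mathbb R^d$.
   Context: Setting: $Q=(Q_{ij})$ is a real $d\times d$ matrix ($d\ge2$) with $Q_{ij}\ge0$ for $i\ne j$ and zero row sums; the graph with edges $\{(i,j):i\ne j,\,Q_{ij}>0\}$ is connected. $x^s\in(0,\infty)^d$ satisfies $Q^\intercal x^s=0$, $\sum_i x^s_i=1$, and detailed balance $Q_{ij}x^s_i=Q_{ji}x^s_j$. Put $\omega_{ij}=Q_{ij}x^s_i$. Let $\phi:(0,\infty)\to\mathbb R$ be smooth with $\phi''>0$, $\theta(s,t)=\frac{s-t}{\phi'(s)-\phi'(t)}$ for $s\ne t$, $\theta(s,s)=1/\phi''(s)$. For $x\in(0,\infty)^d$: $K_{ij}(x)=-\omega_{ij}\theta(x_i/x^s_i,x_j/x^s_j)$ for $j\ne i$ and $K_{ii}(x)=-\sum_{j\ne i}K_{ij}(x)$. $K(x)$ is symmetric, positive semidefinite, has zero row sums and kernel spanned by $(1,\dots,1)$; in these coordinates $(g^{ij})$ is the upper-left $(d-1)\times(d-1)$ block of $K$ and $\det(g_{ij})=|g|$. *)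

theory Defs
  imports "HOL-Analysis.Analysis" "HOL-Computational_Algebra.Polynomial"
begin

text \<open>Vectors in R^d are real^'n with d = CARD('n). The distinguished index dl plays the
role of the last coordinate e_d; the chart coordinates are the components y$i, i \<noteq> dl.\<close>

definition smooth_pos :: "(real \<Rightarrow> real) \<Rightarrow> bool" where
  "smooth_pos \<phi> \<longleftrightarrow> (\<forall>k. \<forall>t>0. ((deriv ^^ k) \<phi>) differentiable (at t))"

definition theta :: "(real \<Rightarrow> real) \<Rightarrow> real \<Rightarrow> real \<Rightarrow> real" where
  "theta \<phi> s t = (if s = t then 1 / deriv (deriv \<phi>) s
                   else (s - t) / (deriv \<phi> s - deriv \<phi> t))"

definition Kmat :: "real^'n^'n \<Rightarrow> real^'n \<Rightarrow> (real \<Rightarrow> real) \<Rightarrow> real^'n \<Rightarrow> real^'n^'n" where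
  "Kmat Q xs \<phi> x = (\<chi> i j. if i \<noteq> j
       then - ((Q$i$j * xs$i) * theta \<phi> (x$i / xs$i) (x$j / xs$j))
       else (\<Sum>k\<in>UNIV - {i}. (Q$i$k * xs$i) * theta \<phi> (x$i / xs$i) (x$k / xs$k)))"

definition charpoly :: "real^'n^'n \<Rightarrow> real poly" where
  "charpoly A = det (\<chi> i j. (if i = j then [:0, 1:] else 0) - [:A$i$j:])"

definition pos_eig_prod :: "real^'n^'n \<Rightarrow> real" where
  "pos_eig_prod A = (\<Prod>r\<in>{r. r > 0 \<and> poly (charpoly A) r = 0}. r ^ order r (charpoly A))"

definition detg :: "real^'n^'n \<Rightarrow> real" where
  "detg A = real CARD('n) / pos_eig_prod A"

definition pinv :: "real^'n^'n \<Rightarrow> real^'n^'n" where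
  "pinv A = (THE B. A ** B ** A = A \<and> B ** A ** B = B \<and>
                    transpose (A ** B) = A ** B \<and> transpose (B ** A) = B ** A)"

definition glow :: "'n \<Rightarrow> real^'n^'n \<Rightarrow> 'n \<Rightarrow> 'n \<Rightarrow> real" where
  "glow dl A i j = (axis i 1 - axis dl 1) \<bullet> (pinv A *v (axis j 1 - axis dl 1))"

text \<open>Inverse matrix (g^ij), i, j \<noteq> dl: inverse of the (d-1)x(d-1) block, computed as the
  inverse of the block-diagonal matrix diag((g_ij), 1).\<close>
definition gup :: "'n \<Rightarrow> real^'n^'n \<Rightarrow> real^'n^'n" where
  "gup dl A = matrix_inv (\<chi> i j. if i \<noteq> dl \<and> j \<noteq> dl then glow dl A i j
                                  else if i = dl \<and> j = dl then 1 else 0)"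

definition pd :: "(real^'n \<Rightarrow> real) \<Rightarrow> 'n \<Rightarrow> real^'n \<Rightarrow> real" where
  "pd f i x = deriv (\<lambda>t. f (x + t *\<^sub>R axis i 1)) 0"

definition egrad :: "(real^'n \<Rightarrow> real) \<Rightarrow> real^'n \<Rightarrow> real^'n" where
  "egrad f x = (\<chi> i. pd f i x)"

definition C2_on :: "(real^'n) set \<Rightarrow> (real^'n \<Rightarrow> real) \<Rightarrow> bool" where
  "C2_on S f \<longleftrightarrow> f differentiable_on S \<and> (\<forall>i. pd f i differentiable_on S) \<and>
                  (\<forall>i j. continuous_on S (pd (pd f i) j))"

text \<open>Chart: (x^i)_{i \<noteq> dl} \<mapsto> point of the simplex with x^dl = 1 - sum of the others.
  The dl-component of the argument is ignored.\<close>
definition lift :: "'n \<Rightarrow> real^'n \<Rightarrow> real^'n" where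
  "lift dl y = (\<chi> i. if i = dl then 1 - (\<Sum>j\<in>UNIV - {dl}. y$j) else y$i)"

end

theory Submission
  imports Defs "HOL-Computational_Algebra.Fundamental_Theorem_Algebra"
begin

text \<open>
  On the open orthant, K(x) is the Laplacian of the graph of Q with the positive edge weights
  omega_ij theta(x_i/xs_i, x_j/xs_j); connectedness makes it positive semidefinite with kernel
  spanned by (1, ..., 1). Hence its pseudoinverse is (K + J)^(-1) - J, with J the orthogonal
  projection onto the constants, and the block (g_ij) of chart metric coefficients is inverted
  exactly by the block (K_ij) with i, j distinct from d. The product of the positive eigenvalues of K
  is, up to sign, the linear coefficient of its characteristic polynomial, that is the sum over j
  of det(K + e_j e_j^T); so |g| depends differentiably on x, because the divided difference of
  phi' does.

  In the chart, dF/dx^j = df/dx_j - df/dx_d. Since K has zero row sums, the chart fluxes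
  sqrt|g| g^ij dF/dx^j summed over j are the Euclidean fluxes sqrt|g| (K grad f)_i, and since it
  has zero column sums these Euclidean fluxes add up to zero. Differentiating the i-th flux along
  e_i - e_d and summing over i therefore gives the Euclidean divergence, the e_d-components
  cancelling. The energy identity is the same computation without derivatives.
\<close>

lemma sum_UNIV_Diff_singleton:
  "(\<Sum>j\<in>UNIV - {k :: 'n::finite}. f j) = (\<Sum>j\<in>UNIV. f j) - (f k :: 'a::ab_group_add)"
  by (simp add: sum_diff1)

lemma sum_delta_mult:
  "(\<Sum>k\<in>(UNIV :: 'n::finite set). (if i = k then c else 0) * f k) = c * (f i :: 'a::semiring_1)"
proof -
  have "(\<Sum>k\<in>UNIV. (if i = k then c else 0) * f k) = (\<Sum>k\<in>UNIV. if k = i then c * f k else 0)"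
    by (intro sum.cong) auto
  then show ?thesis
    by simp
qed

lemma matrix_add_rdistrib: "((A :: 'a::semiring_1^'m^'n) + B) ** (C :: 'a^'k^'m) = A ** C + B ** C"
  by (simp add: matrix_matrix_mult_def vec_eq_iff algebra_simps sum.distrib)

lemma matrix_diff_ldistrib: "(C :: 'a::ring_1^'m^'n) ** ((A :: 'a^'k^'m) - B) = C ** A - C ** B"
  by (simp add: matrix_matrix_mult_def vec_eq_iff algebra_simps sum_subtractf)

lemma matrix_diff_rdistrib: "((A :: 'a::ring_1^'m^'n) - B) ** (C :: 'a^'k^'m) = A ** C - B ** C"
  by (simp add: matrix_matrix_mult_def vec_eq_iff algebra_simps sum_subtractf)

lemma transpose_diff: "transpose ((A :: 'a::ring_1^'m^'n) - B) = transpose A - transpose B"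
  by (simp add: transpose_def vec_eq_iff)

lemma matrix_inv_eqI:
  fixes A B :: "'a::field^'n^'n"
  assumes "B ** A = mat 1"
  shows "matrix_inv A = B"
proof -
  have AB: "A ** B = mat 1"
    using assms matrix_left_right_inverse by blast
  have inv: "A ** matrix_inv A = mat 1"
    unfolding matrix_inv_def by (rule conjunct1[OF someI[of _ B]]) (use assms AB in blast)
  have "matrix_inv A = (B ** A) ** matrix_inv A"
    using assms by simp
  also have "\<dots> = B"
    using inv by (metis matrix_mul_assoc matrix_mul_rid)
  finally show ?thesis .
qed

lemma det_eq_0_iff_nontrivial_kernel:
  fixes M :: "'a::field^'n^'n"
  shows "det M = 0 \<longleftrightarrow> (\<exists>v. v \<noteq> 0 \<and> M *v v = 0)"
proof -
  have "det M \<noteq> 0 \<longleftrightarrow> inj ((*v) M)"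
    using invertible_det_nz invertible_left_inverse matrix_left_invertible_injective by blast
  also have "\<dots> \<longleftrightarrow> (\<forall>v. M *v v = 0 \<longrightarrow> v = 0)"
    by (metis (no_types, lifting) eq_iff_diff_eq_0 injI matrix_vector_mult_0_right
        matrix_vector_mult_diff_distrib injD)
  finally show ?thesis by blast
qed

lemma shifted_matrix_mult_vec:
  fixes M :: "'a::comm_ring_1^'n^'n"
  shows "(\<chi> i k. (if i = k then z else 0) - M $ i $ k) *v v = z *s v - M *v v"
  by (simp add: vec_eq_iff matrix_vector_mult_def left_diff_distrib sum_subtractf sum_delta_mult)

lemma det_pos_if_pos_definite:
  fixes B :: "real^'n^'n"
  assumes pd: "\<And>v. v \<noteq> 0 \<Longrightarrow> v \<bullet> (B *v v) > 0"
  shows "det B > 0"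
proof -
  \<comment> \<open>along the segment from the identity to B the matrices stay nonsingular, so det keeps its sign\<close>
  define C where "C s = (\<chi> i k. s * B $ i $ k + (1 - s) * (if i = k then 1 else 0))" for s :: real
  have Cv: "C s *v v = s *\<^sub>R (B *v v) + (1 - s) *\<^sub>R v" for s v
  proof -
    have "(\<Sum>k\<in>UNIV. (s * B $ i $ k + (1 - s) * (if i = k then 1 else 0)) * v $ k)
        = (\<Sum>k\<in>UNIV. s * (B $ i $ k * v $ k) + (if i = k then (1 - s) * v $ k else 0))" for i
      by (rule sum.cong) (auto simp: algebra_simps)
    then have "(\<Sum>k\<in>UNIV. (s * B $ i $ k + (1 - s) * (if i = k then 1 else 0)) * v $ k)
        = s * (\<Sum>k\<in>UNIV. B $ i $ k * v $ k) + (1 - s) * v $ i" for i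
      by (simp add: sum.distrib sum_distrib_left)
    then show ?thesis
      by (simp add: C_def matrix_vector_mult_def vec_eq_iff)
  qed
  have nonsingular: "det (C s) \<noteq> 0" if s: "0 \<le> s" "s \<le> 1" for s
  proof
    assume "det (C s) = 0"
    then obtain v where v: "v \<noteq> 0" "C s *v v = 0"
      using det_eq_0_iff_nontrivial_kernel by blast
    have "0 < s * (v \<bullet> (B *v v)) + (1 - s) * (v \<bullet> v)"
      using s pd[OF v(1)] v(1)
      by (cases "s = 0") (auto intro: add_pos_nonneg)
    also have "\<dots> = v \<bullet> (C s *v v)"
      by (simp add: Cv inner_add_right)
    finally show False
      using v by simp
  qed
  have "continuous_on {0..1} (\<lambda>s. det (C s))"
    unfolding det_def C_def by (simp, intro continuous_intros)
  moreover have "C 0 = mat 1" "C 1 = B"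
    by (simp_all add: C_def mat_def vec_eq_iff)
  ultimately show ?thesis
    using IVT2'[of "\<lambda>s. det (C s)" 1 0 0] nonsingular by force
qed

subsection \<open>Laplacian matrices and their pseudoinverse\<close>

lemma penrose_conditions_unique:
  fixes A B C :: "'a::comm_semiring_1^'n^'n"
  assumes B: "A ** B ** A = A" "B ** A ** B = B" "transpose (A ** B) = A ** B"
      "transpose (B ** A) = B ** A"
    and C: "A ** C ** A = A" "C ** A ** C = C" "transpose (A ** C) = A ** C"
      "transpose (C ** A) = C ** A"
  shows "B = C"
proof -
  have AB: "A ** B = A ** C"
  proof -
    have "A ** B = (A ** C ** A) ** B"
      using C(1) by simp
    also have "\<dots> = transpose (A ** C) ** transpose (A ** B)"
      using B(3) C(3) by (simp add: matrix_mul_assoc)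
    also have "\<dots> = transpose ((A ** B ** A) ** C)"
      by (simp add: matrix_transpose_mul matrix_mul_assoc)
    finally show ?thesis
      using B(1) C(3) by simp
  qed
  have BA: "B ** A = C ** A"
  proof -
    have "B ** A = B ** (A ** C ** A)"
      using C(1) by simp
    also have "\<dots> = transpose (B ** A) ** transpose (C ** A)"
      using B(4) C(4) by (simp add: matrix_mul_assoc)
    also have "\<dots> = transpose (C ** (A ** B ** A))"
      by (simp add: matrix_transpose_mul matrix_mul_assoc)
    finally show ?thesis
      using B(1) C(4) by simp
  qed
  have "B = B ** (A ** B)"
    using B(2) by (simp add: matrix_mul_assoc)
  also have "\<dots> = (B ** A) ** C"
    using AB by (simp add: matrix_mul_assoc)
  also have "\<dots> = C"
    using BA C(2) by simp
  finally show ?thesis .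
qed

lemma pinv_eqI:
  fixes A B :: "real^'n^'n"
  assumes "A ** B ** A = A" "B ** A ** B = B" "transpose (A ** B) = A ** B"
    "transpose (B ** A) = B ** A"
  shows "pinv A = B"
  unfolding pinv_def using assms penrose_conditions_unique[of A _ B] by blast

definition const_proj :: "real^'n^'n" where
  "const_proj = (\<chi> i j. 1 / real CARD('n))"

lemma const_proj_idem: "const_proj ** const_proj = (const_proj :: real^'n^'n)"
  by (simp add: const_proj_def matrix_matrix_mult_def vec_eq_iff)

lemma transpose_const_proj: "transpose (const_proj :: real^'n^'n) = const_proj"
  by (simp add: const_proj_def transpose_def vec_eq_iff)

lemma const_proj_mult_vec: "(const_proj *v (v :: real^'n)) $ i = (\<Sum>j\<in>UNIV. v $ j) / real CARD('n)"
  by (simp add: const_proj_def matrix_vector_mult_def sum_divide_distrib)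

locale laplacian_matrix =
  fixes A :: "real^'n^'n"
  assumes sym: "A $ i $ j = A $ j $ i"
    and row_sum_zero: "(\<Sum>j\<in>UNIV. A $ i $ j) = 0"
begin

lemma transpose_eq: "transpose A = A"
  using sym by (simp add: transpose_def vec_eq_iff)

lemma column_sum_zero: "(\<Sum>i\<in>UNIV. A $ i $ j) = 0"
proof -
  have "(\<Sum>i\<in>UNIV. A $ i $ j) = (\<Sum>i\<in>UNIV. A $ j $ i)"
    by (intro sum.cong refl sym)
  then show ?thesis
    by (simp add: row_sum_zero)
qed

lemma mult_const_proj: "A ** const_proj = 0"
  using row_sum_zero by (simp add: const_proj_def matrix_matrix_mult_def vec_eq_iff
      sum_divide_distrib[symmetric])

lemma const_proj_mult: "const_proj ** A = 0"
  using mult_const_proj by (metis matrix_transpose_mul transpose_const_proj transpose_eq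
      transpose_mat mat_0)

lemma sum_mult_vec: "(\<Sum>k\<in>UNIV. (A *v v) $ k) = 0"
proof -
  have "(\<Sum>k\<in>UNIV. (A *v v) $ k) = (\<Sum>k\<in>UNIV. \<Sum>j\<in>UNIV. A $ k $ j * v $ j)"
    by (simp add: matrix_vector_mult_def)
  also have "\<dots> = (\<Sum>j\<in>UNIV. \<Sum>k\<in>UNIV. A $ k $ j * v $ j)"
    by (rule sum.swap)
  also have "\<dots> = (\<Sum>j\<in>UNIV. (\<Sum>k\<in>UNIV. A $ k $ j) * v $ j)"
    by (simp add: sum_distrib_right)
  finally show ?thesis
    by (simp add: column_sum_zero)
qed

lemma mult_vec_shift: "(\<Sum>j\<in>UNIV - {k}. A $ i $ j * (w $ j - w $ k)) = (A *v w) $ i"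
proof -
  have "(\<Sum>j\<in>UNIV. A $ i $ j * (w $ j - w $ k)) = (\<Sum>j\<in>UNIV. A $ i $ j * w $ j)"
    using row_sum_zero[of i]
    by (simp add: right_diff_distrib sum_subtractf sum_distrib_right[symmetric])
  then show ?thesis
    by (simp add: sum_UNIV_Diff_singleton matrix_vector_mult_def)
qed

lemma quadratic_form_shift:
  "(\<Sum>i\<in>UNIV - {k}. \<Sum>j\<in>UNIV - {k}. A $ i $ j * (w $ i - w $ k) * (w $ j - w $ k))
     = w \<bullet> (A *v w)"
proof -
  have "(\<Sum>i\<in>UNIV - {k}. \<Sum>j\<in>UNIV - {k}. A $ i $ j * (w $ i - w $ k) * (w $ j - w $ k))
      = (\<Sum>i\<in>UNIV - {k}. (w $ i - w $ k) * (A *v w) $ i)"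
    by (simp add: mult_vec_shift[where k = k, symmetric] sum_distrib_left mult_ac)
  also have "\<dots> = (\<Sum>i\<in>UNIV. w $ i * (A *v w) $ i) - w $ k * (\<Sum>i\<in>UNIV. (A *v w) $ i)"
    by (simp add: sum_UNIV_Diff_singleton left_diff_distrib sum_subtractf sum_distrib_left)
  finally show ?thesis
    by (simp add: sum_mult_vec inner_vec_def)
qed

end

locale psd_laplacian = laplacian_matrix A for A :: "real^'n^'n" +
  assumes psd: "0 \<le> v \<bullet> (A *v v)"
    and quadratic_form_zero_imp_const: "v \<bullet> (A *v v) = 0 \<Longrightarrow> v $ i = v $ j"
begin

lemma inj_plus_const_proj: "inj ((*v) (A + const_proj))"
proof -
  have kernel: "v = 0" if v: "(A + const_proj) *v v = 0" for v
  proof -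
    have "const_proj *v v = const_proj *v ((A + const_proj) *v v)"
      by (simp add: matrix_vector_mul_assoc matrix_add_ldistrib const_proj_mult const_proj_idem)
    then have Jv: "const_proj *v v = 0"
      using v by simp
    then have "A *v v = 0"
      using v by (simp add: matrix_vector_mult_add_rdistrib)
    then have const: "v $ j = v $ i" for i j
      by (intro quadratic_form_zero_imp_const) simp
    have "(const_proj *v v) $ i = v $ i" for i
    proof -
      have "(\<Sum>j\<in>UNIV. v $ j) = (\<Sum>j\<in>(UNIV :: 'n set). v $ i)"
        by (rule sum.cong) (auto intro: const)
      then show ?thesis
        by (simp add: const_proj_mult_vec)
    qed
    then have "const_proj *v v = v"
      by (simp add: vec_eq_iff)
    then show ?thesis
      using Jv by simp
  qed
  show ?thesis
  proof (rule injI)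
    fix a b
    assume "(A + const_proj) *v a = (A + const_proj) *v b"
    then have "(A + const_proj) *v (a - b) = 0"
      by (simp add: matrix_vector_mult_diff_distrib)
    then show "a = b"
      using kernel by fastforce
  qed
qed

lemma mult_pinv: "A ** pinv A = mat 1 - const_proj"
proof -
  obtain M where M: "M ** (A + const_proj) = mat 1"
    using inj_plus_const_proj matrix_left_invertible_injective by blast
  then have M': "(A + const_proj) ** M = mat 1"
    using matrix_left_right_inverse by blast
  have JM: "const_proj ** M = const_proj"
    using arg_cong[OF M', of "(**) const_proj"]
    by (simp add: matrix_mul_assoc matrix_add_ldistrib const_proj_mult const_proj_idem)
  have MJ: "M ** const_proj = const_proj"
    using arg_cong[OF M, of "\<lambda>X. X ** const_proj"]
    by (simp add: matrix_mul_assoc[symmetric] matrix_add_rdistrib mult_const_proj const_proj_idem)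
  define P where "P = M - const_proj"
  have "A ** M = (A + const_proj) ** M - const_proj ** M"
    by (simp add: matrix_add_rdistrib)
  then have AP: "A ** P = mat 1 - const_proj"
    using M' JM by (simp add: P_def matrix_diff_ldistrib mult_const_proj)
  have "M ** A = M ** (A + const_proj) - M ** const_proj"
    by (simp add: matrix_add_ldistrib)
  then have PA: "P ** A = mat 1 - const_proj"
    using M MJ by (simp add: P_def matrix_diff_rdistrib const_proj_mult)
  have JP: "const_proj ** P = 0"
    by (simp add: P_def matrix_diff_ldistrib JM const_proj_idem)
  have "pinv A = P"
  proof (rule pinv_eqI)
    have "A ** P ** A = (mat 1 - const_proj) ** A"
      using AP by simp
    then show "A ** P ** A = A"
      by (simp add: matrix_diff_rdistrib const_proj_mult)
    have "P ** A ** P = (mat 1 - const_proj) ** P"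
      using PA by simp
    then show "P ** A ** P = P"
      by (simp add: matrix_diff_rdistrib JP)
  qed (simp_all add: AP PA transpose_diff transpose_const_proj)
  with AP show ?thesis
    by simp
qed

end

definition embed_block :: "'n \<Rightarrow> ('n \<Rightarrow> 'n \<Rightarrow> real) \<Rightarrow> real^'n^'n" where
  "embed_block k B = (\<chi> i j. if i \<noteq> k \<and> j \<noteq> k then B i j else if i = k \<and> j = k then 1 else 0)"

lemma embed_block_mult:
  "embed_block k B ** embed_block k C = embed_block k (\<lambda>i l. \<Sum>j\<in>UNIV - {k}. B i j * C j l)"
proof -
  have "(\<Sum>j\<in>UNIV. embed_block k B $ i $ j * embed_block k C $ j $ l)
      = embed_block k (\<lambda>i l. \<Sum>j\<in>UNIV - {k}. B i j * C j l) $ i $ l" for i l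
  proof (cases "i = k \<or> l = k")
    case True
    then have "(\<Sum>j\<in>UNIV. embed_block k B $ i $ j * embed_block k C $ j $ l)
        = (\<Sum>j\<in>UNIV. if j = k then (if i = k \<and> l = k then 1 else 0) else 0)"
      by (intro sum.cong) (auto simp: embed_block_def)
    then show ?thesis
      using True by (auto simp: embed_block_def)
  next
    case False
    then have "(\<Sum>j\<in>UNIV. embed_block k B $ i $ j * embed_block k C $ j $ l)
        = (\<Sum>j\<in>UNIV - {k}. embed_block k B $ i $ j * embed_block k C $ j $ l)"
      by (subst sum.remove[of UNIV k]) (auto simp: embed_block_def)
    also have "\<dots> = (\<Sum>j\<in>UNIV - {k}. B i j * C j l)"
      using False by (intro sum.cong) (auto simp: embed_block_def)
    finally show ?thesis
      using False by (simp add: embed_block_def)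
  qed
  then show ?thesis
    by (simp add: matrix_matrix_mult_def vec_eq_iff)
qed

lemma embed_block_delta: "embed_block k (\<lambda>i j. if i = j then 1 else 0) = mat 1"
  by (auto simp: embed_block_def mat_def vec_eq_iff)

lemma gup_eq_inv_embed_block: "gup k A = matrix_inv (embed_block k (glow k A))"
  by (simp add: gup_def embed_block_def)

lemma glow_eq:
  "glow k A i j = (pinv A *v (axis j 1 - axis k 1)) $ i - (pinv A *v (axis j 1 - axis k 1)) $ k"
  by (simp add: glow_def inner_diff_left inner_axis')

context psd_laplacian
begin

lemma sum_mult_glow:
  assumes "i \<noteq> k"
  shows "(\<Sum>j\<in>UNIV - {k}. A $ i $ j * glow k A j l) = (if i = l then 1 else 0)"
proof -
  let ?e = "axis l 1 - axis k (1::real)"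
  have "const_proj *v ?e = 0"
    by (simp add: vec_eq_iff const_proj_mult_vec sum_subtractf axis_def)
  then have "A *v (pinv A *v ?e) = ?e"
    by (simp add: matrix_vector_mul_assoc mult_pinv matrix_vector_mult_diff_rdistrib)
  then show ?thesis
    using assms by (simp add: glow_eq mult_vec_shift axis_def)
qed

lemma gup_eq:
  assumes "i \<noteq> k" "j \<noteq> k"
  shows "gup k A $ i $ j = A $ i $ j"
proof -
  have "embed_block k (\<lambda>i j. A $ i $ j) ** embed_block k (glow k A)
      = embed_block k (\<lambda>i j. if i = j then 1 else 0)"
    unfolding embed_block_mult by (auto simp: embed_block_def sum_mult_glow vec_eq_iff)
  then have "gup k A = embed_block k (\<lambda>i j. A $ i $ j)"
    by (simp add: gup_eq_inv_embed_block embed_block_delta matrix_inv_eqI)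
  with assms show ?thesis
    by (simp add: embed_block_def)
qed

end

subsection \<open>The characteristic polynomial\<close>

lemma coeff_prod_linear:
  fixes a b :: "'i \<Rightarrow> 'a::comm_ring_1"
  assumes "finite S"
  shows "coeff (\<Prod>i\<in>S. [:b i, a i:]) 0 = (\<Prod>i\<in>S. b i)"
    and "coeff (\<Prod>i\<in>S. [:b i, a i:]) 1 = (\<Sum>j\<in>S. a j * (\<Prod>i\<in>S - {j}. b i))"
proof -
  have "coeff (\<Prod>i\<in>S. [:b i, a i:]) 0 = (\<Prod>i\<in>S. b i)
      \<and> coeff (\<Prod>i\<in>S. [:b i, a i:]) 1 = (\<Sum>j\<in>S. a j * (\<Prod>i\<in>S - {j}. b i))"
    using assms
  proof (induction S rule: finite_induct)
    case (insert x S)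
    have S: "insert x S - {j} = insert x (S - {j})" if "j \<in> S" for j
      using insert.hyps that by auto
    have "(\<Sum>j\<in>insert x S. a j * (\<Prod>i\<in>insert x S - {j}. b i))
        = a x * (\<Prod>i\<in>S. b i) + b x * (\<Sum>j\<in>S. a j * (\<Prod>i\<in>S - {j}. b i))"
      using insert.hyps by (simp add: S sum_distrib_left mult_ac cong: sum.cong)
    moreover have "[:b x, a x:] * (\<Prod>i\<in>S. [:b i, a i:])
        = smult (b x) (\<Prod>i\<in>S. [:b i, a i:]) + pCons 0 (smult (a x) (\<Prod>i\<in>S. [:b i, a i:]))"
      by simp
    ultimately show ?case
      using insert by (simp add: coeff_pCons)
  qed simp
  then show "coeff (\<Prod>i\<in>S. [:b i, a i:]) 0 = (\<Prod>i\<in>S. b i)"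
    and "coeff (\<Prod>i\<in>S. [:b i, a i:]) 1 = (\<Sum>j\<in>S. a j * (\<Prod>i\<in>S - {j}. b i))"
    by blast+
qed

lemma coeff_prod_linear_top:
  fixes a b :: "'i \<Rightarrow> 'a::comm_ring_1"
  assumes "finite S"
  shows "degree (\<Prod>i\<in>S. [:b i, a i:]) \<le> card S
       \<and> coeff (\<Prod>i\<in>S. [:b i, a i:]) (card S) = (\<Prod>i\<in>S. a i)"
  using assms
proof (induction S rule: finite_induct)
  case (insert x S)
  let ?P = "\<Prod>i\<in>S. [:b i, a i:]"
  have expand: "[:b x, a x:] * ?P = smult (b x) ?P + pCons 0 (smult (a x) ?P)"
    by simp
  have "degree [:b x, a x:] \<le> 1"
    by simp
  then have "degree ([:b x, a x:] * ?P) \<le> Suc (card S)"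
    using degree_mult_le[of "[:b x, a x:]" ?P] insert.IH by linarith
  moreover have "coeff ?P (Suc (card S)) = 0"
    using insert by (simp add: coeff_eq_0)
  ultimately show ?case
    using insert expand by simp
qed simp

lemma charpoly_altdef:
  "charpoly A = (\<Sum>p\<in>{p. p permutes (UNIV :: 'n set)}. of_int (sign p) *
     (\<Prod>i\<in>UNIV. [: - (A :: real^'n^'n) $ i $ p i, if i = p i then 1 else 0 :]))"
  unfolding charpoly_def det_def
  by (intro sum.cong refl arg_cong2[where f = "(*)"] prod.cong) auto

lemma coeff_of_int_mult: "coeff (of_int k * p) n = of_int k * coeff (p :: 'a::comm_ring_1 poly) n"
  by (simp add: of_int_poly)

lemma charpoly_coeff_0: "coeff (charpoly A) 0 = det (- A :: real^'n^'n)"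
  unfolding charpoly_altdef coeff_sum coeff_of_int_mult det_def
  by (intro sum.cong refl) (simp add: coeff_prod_linear(1))

lemma charpoly_coeff_1_rows:
  "coeff (charpoly (A :: real^'n^'n)) 1 = (\<Sum>j\<in>UNIV. det (\<chi> i. if i = j then axis j 1 else - A $ i))"
proof -
  have "coeff (charpoly A) 1 = (\<Sum>p\<in>{p. p permutes (UNIV :: 'n set)}. of_int (sign p) *
      (\<Sum>j\<in>UNIV. (if j = p j then 1 else 0) * (\<Prod>i\<in>UNIV - {j}. - A $ i $ p i)))"
    unfolding charpoly_altdef coeff_sum coeff_of_int_mult
  proof (intro sum.cong refl)
    fix p :: "'n \<Rightarrow> 'n"
    show "of_int (sign p) * coeff (\<Prod>i\<in>UNIV. [: - A $ i $ p i, if i = p i then 1 else 0 :]) 1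
        = of_int (sign p) * (\<Sum>j\<in>UNIV. (if j = p j then 1 else 0) * (\<Prod>i\<in>UNIV - {j}. - A $ i $ p i))"
      using coeff_prod_linear(2)[where S = UNIV and b = "\<lambda>i. - A $ i $ p i"
          and a = "\<lambda>i. if i = p i then 1 else 0"] by simp
  qed
  also have "\<dots> = (\<Sum>j\<in>UNIV. \<Sum>p\<in>{p. p permutes (UNIV :: 'n set)}. of_int (sign p) *
      ((if j = p j then 1 else 0) * (\<Prod>i\<in>UNIV - {j}. - A $ i $ p i)))"
    by (simp add: sum_distrib_left sum.swap[of _ UNIV])
  also have "\<dots> = (\<Sum>j\<in>UNIV. det (\<chi> i. if i = j then axis j 1 else - A $ i))"
    unfolding det_def
  proof (intro sum.cong refl)
    fix j and p :: "'n \<Rightarrow> 'n"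
    let ?R = "\<chi> i. if i = j then axis j 1 else - A $ i"
    have R: "?R $ i $ k = (if i = j then (if k = j then 1 else 0) else - A $ i $ k)" for i k
      by (simp add: axis_def)
    have "(\<Prod>i\<in>UNIV. ?R $ i $ p i) = ?R $ j $ p j * (\<Prod>i\<in>UNIV - {j}. ?R $ i $ p i)"
      by (rule prod.remove) auto
    also have "(\<Prod>i\<in>UNIV - {j}. ?R $ i $ p i) = (\<Prod>i\<in>UNIV - {j}. - A $ i $ p i)"
      by (intro prod.cong) (simp_all add: R)
    finally show "of_int (sign p) * ((if j = p j then 1 else 0) * (\<Prod>i\<in>UNIV - {j}. - A $ i $ p i))
        = of_int (sign p) * (\<Prod>i\<in>UNIV. ?R $ i $ p i)"
      by (simp only: R) (simp add: eq_commute)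
  qed
  finally show ?thesis .
qed

definition diag_unit :: "'n \<Rightarrow> real^'n^'n" where
  "diag_unit j = (\<chi> a b. if a = j \<and> b = j then 1 else 0)"

lemma diag_unit_mult_vec: "diag_unit j *v v = axis j (v $ j)"
  unfolding diag_unit_def matrix_vector_mult_def axis_def vec_eq_iff
  by (auto simp: if_distrib if_distribR cong: if_cong)

lemma det_neg_rows_but_axis:
  "det (\<chi> i. if i = j then axis j 1 else - A $ i)
     = (-1) ^ (CARD('n) - 1) * (det (A + diag_unit j) - det (A :: real^'n^'n))"
proof -
  let ?c = "\<lambda>i. if i = j then 1 else - 1 :: real"
  let ?N = "\<chi> i. if i = j then axis j 1 else A $ i"
  have rows: "(\<chi> i. if i = j then axis j 1 else - A $ i) = (\<chi> i. ?c i *s ?N $ i)"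
    by (simp add: vec_eq_iff)
  have "prod ?c UNIV = ?c j * prod ?c (UNIV - {j})"
    by (rule prod.remove) auto
  also have "prod ?c (UNIV - {j}) = prod (\<lambda>_. - 1) (UNIV - {j})"
    by (rule prod.cong) auto
  finally have sign: "prod ?c UNIV = (-1) ^ (CARD('n) - 1)"
    by (simp add: card_Diff_singleton)
  have "A + diag_unit j = (\<chi> i. if i = j then A $ i + axis j 1 else A $ i)"
    by (simp add: diag_unit_def vec_eq_iff axis_def)
  moreover have "(\<chi> i. if i = j then A $ j else A $ i) = A"
    by (simp add: vec_eq_iff)
  ultimately have "det (A + diag_unit j) = det A + det ?N"
    using det_row_add[of j "\<lambda>i. A $ i" "\<lambda>i. axis j 1" "\<lambda>i. A $ i"]
    by (simp add: if_distrib cong: if_cong)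
  with rows sign show ?thesis
    by (simp add: det_rows_mul)
qed

lemma charpoly_coeff_1:
  "coeff (charpoly A) 1 = (-1) ^ (CARD('n) - 1) * (\<Sum>j\<in>UNIV. det (A + diag_unit j) - det (A :: real^'n^'n))"
  unfolding charpoly_coeff_1_rows det_neg_rows_but_axis by (simp add: sum_distrib_left)

lemma charpoly_monic:
  "degree (charpoly (A :: real^'n^'n)) = CARD('n)" "lead_coeff (charpoly A) = 1"
proof -
  have "degree (charpoly A) \<le> CARD('n)"
    unfolding charpoly_altdef
  proof (intro degree_sum_le)
    fix p
    show "degree (of_int (sign p) * (\<Prod>i\<in>UNIV. [: - A $ i $ p i, if i = p i then 1 else 0 :]))
        \<le> CARD('n)"
      using coeff_prod_linear_top[of UNIV "\<lambda>i. - A $ i $ p i" "\<lambda>i. if i = p i then 1 else 0"]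
      by (intro order_trans[OF degree_mult_le]) simp
  qed simp
  moreover have "coeff (charpoly A) CARD('n) = 1"
  proof -
    have "(\<Prod>i\<in>UNIV. if i = p i then 1 else 0 :: real) = (if p = id then 1 else 0)" for p :: "'n \<Rightarrow> 'n"
      by (auto simp: fun_eq_iff) metis
    then have "coeff (charpoly A) CARD('n)
        = (\<Sum>p\<in>{p. p permutes (UNIV :: 'n set)}. if p = id then 1 else 0)"
      unfolding charpoly_altdef coeff_sum coeff_of_int_mult
      using coeff_prod_linear_top[of UNIV "\<lambda>i. - A $ i $ _ i"]
      by (intro sum.cong refl) simp
    then show ?thesis
      by simp
  qed
  ultimately show "degree (charpoly A) = CARD('n)" "lead_coeff (charpoly A) = 1"
    using le_degree[of "charpoly A" "CARD('n)"] by auto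
qed

lemma map_poly_of_real_add:
  "map_poly (of_real :: real \<Rightarrow> 'a::real_algebra_1) (p + q) = map_poly of_real p + map_poly of_real q"
  by (simp add: poly_eq_iff coeff_map_poly)

lemma map_poly_of_real_mult:
  "map_poly (of_real :: real \<Rightarrow> 'a::{real_algebra_1,comm_ring_1}) (p * q)
     = map_poly of_real p * map_poly of_real q"
  by (simp add: poly_eq_iff coeff_map_poly coeff_mult)

lemma map_poly_of_real_sum:
  "map_poly (of_real :: real \<Rightarrow> 'a::real_algebra_1) (\<Sum>x\<in>S. f x) = (\<Sum>x\<in>S. map_poly of_real (f x))"
  by (induction S rule: infinite_finite_induct) (auto simp: map_poly_of_real_add)

lemma map_poly_of_real_prod:
  "map_poly (of_real :: real \<Rightarrow> 'a::{real_algebra_1,comm_ring_1}) (\<Prod>x\<in>S. f x)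
     = (\<Prod>x\<in>S. map_poly of_real (f x))"
  by (induction S rule: infinite_finite_induct) (auto simp: map_poly_of_real_mult)

lemma map_poly_of_real_of_int:
  "map_poly (of_real :: real \<Rightarrow> 'a::{real_algebra_1,comm_ring_1}) (of_int k) = of_int k"
  by (simp add: poly_eq_iff coeff_map_poly of_int_poly coeff_pCons split: nat.split)

lemma poly_map_poly_of_real:
  "poly (map_poly (of_real :: real \<Rightarrow> 'a::real_field) p) (of_real r) = of_real (poly p r)"
  by (induction p) (auto simp: map_poly_pCons)

lemma poly_map_charpoly:
  fixes z :: "'a::real_field"
  shows "poly (map_poly of_real (charpoly A)) z
       = det (\<chi> i k. (if i = k then z else 0) - of_real ((A :: real^'n^'n) $ i $ k))"
  unfolding charpoly_altdef map_poly_of_real_sum poly_sum det_def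
proof (intro sum.cong refl)
  fix p :: "'n \<Rightarrow> 'n"
  have "poly (map_poly of_real (\<Prod>i\<in>UNIV. [: - A $ i $ p i, if i = p i then 1 else 0 :])) z
      = (\<Prod>i\<in>UNIV. (\<chi> i k. (if i = k then z else 0) - of_real (A $ i $ k)) $ i $ p i)"
    unfolding map_poly_of_real_prod poly_prod
    by (intro prod.cong refl) (auto simp: map_poly_pCons)
  then show "poly (map_poly of_real (of_int (sign p)
        * (\<Prod>i\<in>UNIV. [: - A $ i $ p i, if i = p i then 1 else 0 :]))) z
      = of_int (sign p) * (\<Prod>i\<in>UNIV. (\<chi> i k. (if i = k then z else 0) - of_real (A $ i $ k)) $ i $ p i)"
    by (simp add: map_poly_of_real_mult map_poly_of_real_of_int)
qed

lemma charpoly_root_eigenvector: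
  fixes z :: "'a::real_field"
  assumes "poly (map_poly of_real (charpoly A)) z = 0"
  obtains v where "v \<noteq> 0" "(\<chi> i k. of_real ((A :: real^'n^'n) $ i $ k)) *v v = z *s v"
proof -
  let ?M = "\<chi> i k. of_real (A $ i $ k) :: 'a^'n^'n"
  have "det (\<chi> i k. (if i = k then z else 0) - ?M $ i $ k) = 0"
    using assms by (simp add: poly_map_charpoly)
  then obtain v where v: "v \<noteq> 0" "(\<chi> i k. (if i = k then z else 0) - ?M $ i $ k) *v v = 0"
    using det_eq_0_iff_nontrivial_kernel by blast
  moreover have "(\<chi> i k. (if i = k then z else 0) - ?M $ i $ k) *v v = z *s v - ?M *v v"
    by (rule shifted_matrix_mult_vec)
  ultimately have "z *s v = ?M *v v"
    by simp
  then show ?thesis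
    using that[OF v(1)] by simp
qed

lemma charpoly_roots_real_if_symmetric:
  fixes A :: "real^'n^'n"
  assumes sym: "\<And>i j. A $ i $ j = A $ j $ i"
    and root: "poly (map_poly complex_of_real (charpoly A)) z = 0"
  shows "Im z = 0"
proof -
  let ?M = "\<chi> i k. complex_of_real (A $ i $ k)"
  obtain v where v: "v \<noteq> 0" "?M *v v = z *s v"
    using charpoly_root_eigenvector[OF root] by blast
  define S where "S = (\<Sum>i\<in>UNIV. cnj (v $ i) * (?M *v v) $ i)"
  have "cnj S = (\<Sum>i\<in>UNIV. \<Sum>k\<in>UNIV. complex_of_real (A $ i $ k) * v $ i * cnj (v $ k))"
    by (simp add: S_def matrix_vector_mult_def sum_distrib_left mult_ac)
  also have "\<dots> = S"
    by (subst sum.swap) (simp add: S_def matrix_vector_mult_def sum_distrib_left sym mult_ac)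
  finally have "Im (cnj S) = Im S"
    by simp
  then have "Im S = 0"
    by simp
  moreover have "cnj (v $ i) * v $ i = (complex_of_real (cmod (v $ i)))\<^sup>2" for i
    using complex_norm_square[of "v $ i"] by (simp add: mult.commute)
  then have "S = z * complex_of_real (\<Sum>i\<in>UNIV. (cmod (v $ i))\<^sup>2)"
    unfolding S_def v(2) of_real_sum sum_distrib_left by (simp add: mult_ac)
  moreover have "(\<Sum>i\<in>UNIV. (cmod (v $ i))\<^sup>2) > 0"
  proof -
    obtain i where "v $ i \<noteq> 0"
      using v(1) by (auto simp: vec_eq_iff)
    then show ?thesis
      by (intro sum_pos2[of UNIV i]) auto
  qed
  ultimately show ?thesis
    by simp
qed

lemma real_rooted_poly_decompose:
  fixes p :: "real poly"
  shows "(\<forall>z. poly (map_poly complex_of_real p) z = 0 \<longrightarrow> Im z = 0) \<Longrightarrow>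
    smult (lead_coeff p) (\<Prod>r | poly p r = 0. [:- r, 1:] ^ order r p) = p"
proof (induction p rule: poly_root_order_induct)
  case (no_roots p)
  show ?case
  proof (cases "degree p = 0")
    case False
    then have "\<not> constant (poly (map_poly complex_of_real p))"
      by (subst constant_degree) (simp add: degree_map_poly)
    then obtain z where z: "poly (map_poly complex_of_real p) z = 0"
      using fundamental_theorem_of_algebra by blast
    then have "complex_of_real (Re z) = z"
      using no_roots.prems by (simp add: complex_eq_iff)
    then have "poly (map_poly complex_of_real p) (complex_of_real (Re z)) = 0"
      using z by simp
    then have "complex_of_real (poly p (Re z)) = 0"
      by (simp add: poly_map_poly_of_real)
    then show ?thesis
      using no_roots.hyps by simp
  qed (auto elim!: degree_eq_zeroE)
next
  case (root p x n)
  have real_roots: "\<forall>z. poly (map_poly complex_of_real p) z = 0 \<longrightarrow> Im z = 0"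
    using root.prems by (simp add: map_poly_of_real_mult)
  from root have roots: "{z. poly ([:- x, 1:] ^ n * p) z = 0} = insert x {z. poly p z = 0}"
    by auto
  have "smult (lead_coeff ([:- x, 1:] ^ n * p))
          (\<Prod>z | poly ([:- x, 1:] ^ n * p) z = 0. [:- z, 1:] ^ order z ([:- x, 1:] ^ n * p))
      = [:- x, 1:] ^ order x ([:- x, 1:] ^ n * p)
          * smult (lead_coeff p) (\<Prod>z\<in>{z. poly p z = 0}. [:- z, 1:] ^ order z ([:- x, 1:] ^ n * p))"
    by (subst roots, subst prod.insert)
       (use root in \<open>auto intro: poly_roots_finite simp: mult_ac lead_coeff_mult lead_coeff_power\<close>)
  also have "order x ([:- x, 1:] ^ n * p) = n"
    using root by (subst order_mult) (auto simp: order_power_n_n order_0I)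
  also have "(\<Prod>z\<in>{z. poly p z = 0}. [:- z, 1:] ^ order z ([:- x, 1:] ^ n * p))
      = (\<Prod>z\<in>{z. poly p z = 0}. [:- z, 1:] ^ order z p)"
  proof (intro prod.cong refl)
    fix y
    assume "y \<in> {z. poly p z = 0}"
    with root have "order y ([:- x, 1:] ^ n) = 0"
      by (intro order_0I) auto
    then show "[:- y, 1:] ^ order y ([:- x, 1:] ^ n * p) = [:- y, 1:] ^ order y p"
      using root by (subst order_mult) auto
  qed
  also note root.IH[OF real_roots]
  finally show ?case .
qed simp_all

lemma order_0_eq_1:
  fixes p :: "'a::idom poly"
  assumes "poly p 0 = 0" "coeff p 1 \<noteq> 0"
  shows "order 0 p = 1"
proof -
  have "p \<noteq> 0"
    using assms(2) by auto
  then have "order 0 p \<noteq> 0"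
    using assms(1) order_root by blast
  moreover have "\<not> [:0, 1:] ^ 2 dvd p"
  proof
    assume "[:0, 1:] ^ 2 dvd p"
    then obtain s where "p = pCons 0 (pCons 0 s)"
      by (auto simp: power2_eq_square)
    with assms(2) show False
      by simp
  qed
  then have "order 0 p < 2"
    using order_divides[of 0 2 p] by auto
  ultimately show ?thesis
    by linarith
qed

lemma prod_pos_roots_eq_abs_coeff_1:
  fixes p :: "real poly"
  assumes monic: "lead_coeff p = 1"
    and real_roots: "\<forall>z. poly (map_poly complex_of_real p) z = 0 \<longrightarrow> Im z = 0"
    and nonneg_roots: "\<And>r. poly p r = 0 \<Longrightarrow> r \<ge> 0"
    and "poly p 0 = 0" "coeff p 1 \<noteq> 0"
  shows "(\<Prod>r \<in> {r. r > 0 \<and> poly p r = 0}. r ^ order r p) = \<bar>coeff p 1\<bar>"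
proof -
  define R where "R = {r. r > 0 \<and> poly p r = 0}"
  define m where "m r = order r p" for r
  have "p \<noteq> 0"
    using monic by auto
  then have "finite R"
    unfolding R_def using poly_roots_finite[of p] by (auto intro: finite_subset[of _ "{r. poly p r = 0}"])
  moreover have "0 \<notin> R"
    by (simp add: R_def)
  moreover have "{r. poly p r = 0} = insert 0 R"
    using nonneg_roots \<open>poly p 0 = 0\<close> by (auto simp: R_def less_le)
  then have "p = (\<Prod>r\<in>insert 0 R. [:- r, 1:] ^ m r)"
    using real_rooted_poly_decompose[OF real_roots] monic by (simp add: m_def)
  moreover have "m 0 = 1"
    unfolding m_def using assms(4,5) by (rule order_0_eq_1)
  ultimately have "p = pCons 0 (\<Prod>r\<in>R. [:- r, 1:] ^ m r)"
    by simp
  then have "coeff p 1 = poly (\<Prod>r\<in>R. [:- r, 1:] ^ m r) 0"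
    by (simp add: poly_0_coeff_0)
  also have "\<dots> = (\<Prod>r\<in>R. (- r) ^ m r)"
    by (simp add: poly_prod)
  finally have "\<bar>coeff p 1\<bar> = (\<Prod>r\<in>R. \<bar>r\<bar> ^ m r)"
    by (simp add: abs_prod power_abs)
  also have "\<dots> = (\<Prod>r\<in>R. r ^ m r)"
    by (intro prod.cong) (auto simp: R_def)
  finally show ?thesis
    by (simp add: R_def m_def)
qed

context laplacian_matrix
begin

lemma det_eq_0: "det A = 0"
proof -
  have "A *v 1 = 0" "(1 :: real^'n) \<noteq> 0"
    by (simp_all add: vec_eq_iff matrix_vector_mult_def row_sum_zero)
  then show ?thesis
    using det_eq_0_iff_nontrivial_kernel by blast
qed

lemma det_uminus_eq_0: "det (- A) = 0"
proof -
  have "(- A) *v 1 = 0" "(1 :: real^'n) \<noteq> 0"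
    by (simp_all add: vec_eq_iff matrix_vector_mult_def sum_negf row_sum_zero)
  then show ?thesis
    using det_eq_0_iff_nontrivial_kernel by blast
qed

end

context psd_laplacian
begin

lemma det_plus_diag_unit_pos: "det (A + diag_unit j) > 0"
proof (rule det_pos_if_pos_definite)
  fix v :: "real^'n"
  assume "v \<noteq> 0"
  have quad: "v \<bullet> ((A + diag_unit j) *v v) = v \<bullet> (A *v v) + (v $ j)\<^sup>2"
    by (simp add: matrix_vector_mult_add_rdistrib diag_unit_mult_vec inner_add_right inner_axis
        power2_eq_square)
  show "v \<bullet> ((A + diag_unit j) *v v) > 0"
  proof (cases "v \<bullet> (A *v v) = 0")
    case True
    then have "v $ i = v $ j" for i
      by (rule quadratic_form_zero_imp_const)
    with \<open>v \<noteq> 0\<close> have "v $ j \<noteq> 0"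
      by (auto simp: vec_eq_iff)
    with True quad show ?thesis
      by simp
  next
    case False
    with psd[of v] quad show ?thesis
      by (simp add: add_pos_nonneg)
  qed
qed

lemma charpoly_root_nonneg:
  assumes "poly (charpoly A) r = 0"
  shows "r \<ge> 0"
proof -
  obtain v where v: "v \<noteq> 0" "A *v v = r *s v"
    using charpoly_root_eigenvector[of A r] assms by (auto simp: map_poly_idI)
  then have "0 \<le> r * (v \<bullet> v)"
    using psd[of v] by (simp add: scalar_mult_eq_scaleR)
  moreover have "v \<bullet> v > 0"
    using v(1) by simp
  ultimately show ?thesis
    by (simp add: zero_le_mult_iff)
qed

lemma pos_eig_prod_eq: "pos_eig_prod A = (\<Sum>j\<in>UNIV. det (A + diag_unit j))"
proof -
  have sum_pos: "(\<Sum>j\<in>UNIV. det (A + diag_unit j)) > 0"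
    using det_plus_diag_unit_pos by (simp add: sum_pos)
  have coeff_1: "coeff (charpoly A) 1 = (-1) ^ (CARD('n) - 1) * (\<Sum>j\<in>UNIV. det (A + diag_unit j))"
    unfolding charpoly_coeff_1 det_eq_0 by simp
  have "pos_eig_prod A = \<bar>coeff (charpoly A) 1\<bar>"
    unfolding pos_eig_prod_def
  proof (rule prod_pos_roots_eq_abs_coeff_1)
    show "lead_coeff (charpoly A) = 1"
      by (rule charpoly_monic)
    show "\<forall>z. poly (map_poly complex_of_real (charpoly A)) z = 0 \<longrightarrow> Im z = 0"
      using charpoly_roots_real_if_symmetric sym by blast
    show "poly (charpoly A) 0 = 0"
      by (simp add: poly_0_coeff_0 charpoly_coeff_0 det_uminus_eq_0)
    show "coeff (charpoly A) 1 \<noteq> 0"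
      using coeff_1 sum_pos by simp
  qed (rule charpoly_root_nonneg)
  with coeff_1 sum_pos show ?thesis
    by (simp add: abs_mult)
qed

end

subsection \<open>Divided differences\<close>

definition divided_diff :: "(real \<Rightarrow> real) \<Rightarrow> (real \<Rightarrow> real) \<Rightarrow> real \<Rightarrow> real \<Rightarrow> real" where
  "divided_diff g g' s t = (if s = t then g' s else (g s - g t) / (s - t))"

lemma divided_diff_approx:
  assumes "\<bar>s - s0\<bar> \<le> r" "\<bar>t - s0\<bar> \<le> r"
    and deriv: "\<And>w. \<bar>w - s0\<bar> \<le> r \<Longrightarrow> (g has_real_derivative g' w) (at w)"
    and bound: "\<And>w. \<bar>w - s0\<bar> \<le> r \<Longrightarrow> \<bar>g' w - a - c * (w - s0)\<bar> \<le> e"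
  shows "\<bar>divided_diff g g' s t - a - c / 2 * ((s - s0) + (t - s0))\<bar> \<le> e"
proof (cases "s = t")
  case True
  then show ?thesis
    using bound[OF assms(1)] by (simp add: divided_diff_def algebra_simps)
next
  case False
  \<comment> \<open>mean value theorem for g minus its quadratic Taylor polynomial at s0\<close>
  define h where "h w = g w - a * w - c * (w - s0)\<^sup>2 / 2" for w
  define lo where "lo = min s t"
  define hi where "hi = max s t"
  have near: "\<bar>w - s0\<bar> \<le> r" if "lo \<le> w" "w \<le> hi" for w
    using assms(1,2) that by (auto simp: lo_def hi_def abs_le_iff)
  have "lo < hi"
    using False by (simp add: lo_def hi_def)
  moreover have "(h has_real_derivative g' w - a - c * (w - s0)) (at w)" if "lo \<le> w" "w \<le> hi" for w
    unfolding h_def using deriv[OF near[OF that]]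
    by (auto intro!: derivative_eq_intros simp: field_simps power2_eq_square)
  ultimately obtain \<xi> where \<xi>: "lo < \<xi>" "\<xi> < hi" "h hi - h lo = (hi - lo) * (g' \<xi> - a - c * (\<xi> - s0))"
    using MVT2[of lo hi h "\<lambda>w. g' w - a - c * (w - s0)"] by force
  have "divided_diff g g' s t - a - c / 2 * ((s - s0) + (t - s0)) = (h s - h t) / (s - t)"
    using False by (simp add: divided_diff_def h_def field_simps power2_eq_square)
  also have "\<dots> = (h hi - h lo) / (hi - lo)"
    by (cases "s < t") (auto simp: lo_def hi_def min_def max_def field_simps)
  also have "\<dots> = g' \<xi> - a - c * (\<xi> - s0)"
    using \<xi> \<open>lo < hi\<close> by simp
  moreover have "\<bar>g' \<xi> - a - c * (\<xi> - s0)\<bar> \<le> e"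
    using \<xi> by (intro bound near) simp_all
  ultimately show ?thesis
    by (simp only:)
qed

lemma divided_diff_has_derivative_diag:
  assumes "\<delta> > 0"
    and deriv: "\<And>w. \<bar>w - s0\<bar> < \<delta> \<Longrightarrow> (g has_real_derivative g' w) (at w)"
    and deriv2: "(g' has_real_derivative c) (at s0)"
  shows "((\<lambda>p. divided_diff g g' (fst p) (snd p)) has_derivative (\<lambda>p. c / 2 * (fst p + snd p)))
           (at (s0, s0))"
  unfolding has_derivative_at_alt
proof (intro conjI allI impI)
  show "bounded_linear (\<lambda>p::real \<times> real. c / 2 * (fst p + snd p))"
    by (intro bounded_linear_intros)
  fix e :: real
  assume "e > 0"
  then obtain d1 where "d1 > 0" and d1:
    "\<And>w. norm (w - s0) < d1 \<Longrightarrow> norm (g' w - g' s0 - c * (w - s0)) \<le> e * norm (w - s0)"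
    using deriv2 unfolding has_field_derivative_def has_derivative_at_alt by (auto simp: mult.commute)
  have "norm (divided_diff g g' (fst y) (snd y) - divided_diff g g' (fst (s0, s0)) (snd (s0, s0))
      - c / 2 * (fst (y - (s0, s0)) + snd (y - (s0, s0)))) \<le> e * norm (y - (s0, s0))"
    if y: "norm (y - (s0, s0)) < min d1 \<delta>" for y
  proof -
    obtain s t where y_eq: "y = (s, t)"
      by fastforce
    define r where "r = norm (y - (s0, s0))"
    have "\<bar>s - s0\<bar> \<le> r" "\<bar>t - s0\<bar> \<le> r"
      using norm_fst_le[where x = "s - s0" and y = "t - s0"] norm_snd_le[where x = "s - s0" and y = "t - s0"]
      by (simp_all add: r_def y_eq)
    then have "\<bar>divided_diff g g' s t - g' s0 - c / 2 * ((s - s0) + (t - s0))\<bar> \<le> e * r"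
    proof (rule divided_diff_approx)
      fix w
      assume w: "\<bar>w - s0\<bar> \<le> r"
      show "(g has_real_derivative g' w) (at w)"
        using w y by (intro deriv) (simp add: r_def)
      have "\<bar>g' w - g' s0 - c * (w - s0)\<bar> \<le> e * \<bar>w - s0\<bar>"
        using d1[of w] w y by (simp add: r_def)
      also have "\<dots> \<le> e * r"
        using w \<open>e > 0\<close> by simp
      finally show "\<bar>g' w - g' s0 - c * (w - s0)\<bar> \<le> e * r" .
    qed
    then show ?thesis
      by (simp add: y_eq r_def divided_diff_def)
  qed
  moreover have "min d1 \<delta> > 0"
    using \<open>d1 > 0\<close> \<open>\<delta> > 0\<close> by simp
  ultimately show "\<exists>d>0. \<forall>y. norm (y - (s0, s0)) < d \<longrightarrow>
      norm (divided_diff g g' (fst y) (snd y) - divided_diff g g' (fst (s0, s0)) (snd (s0, s0))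
        - c / 2 * (fst (y - (s0, s0)) + snd (y - (s0, s0)))) \<le> e * norm (y - (s0, s0))"
    by blast
qed

lemma divided_diff_differentiable:
  assumes "open I" "s0 \<in> I" "t0 \<in> I"
    and deriv: "\<And>w. w \<in> I \<Longrightarrow> (g has_real_derivative g' w) (at w)"
    and deriv2: "\<And>w. w \<in> I \<Longrightarrow> g' differentiable (at w)"
  shows "(\<lambda>p. divided_diff g g' (fst p) (snd p)) differentiable (at (s0, t0))"
proof (cases "s0 = t0")
  case True
  obtain \<delta> where "\<delta> > 0" and ball: "ball s0 \<delta> \<subseteq> I"
    using \<open>open I\<close> \<open>s0 \<in> I\<close> by (auto simp: open_contains_ball)
  obtain c where "(g' has_real_derivative c) (at s0)"
    using deriv2[OF \<open>s0 \<in> I\<close>] by (auto simp: real_differentiable_def)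
  moreover have "(g has_real_derivative g' w) (at w)" if "\<bar>w - s0\<bar> < \<delta>" for w
    using that ball by (intro deriv) (auto simp: dist_real_def)
  ultimately have "((\<lambda>p. divided_diff g g' (fst p) (snd p)) has_derivative (\<lambda>p. c / 2 * (fst p + snd p)))
      (at (s0, s0))"
    using divided_diff_has_derivative_diag[OF \<open>\<delta> > 0\<close>] by blast
  with True show ?thesis
    by (auto simp: differentiable_def)
next
  case False
  have "(\<lambda>p::real \<times> real. (g (fst p) - g (snd p)) / (fst p - snd p)) differentiable (at (s0, t0))"
  proof (intro differentiable_divide differentiable_diff)
    show "(\<lambda>p::real \<times> real. g (fst p)) differentiable (at (s0, t0))"
      using differentiable_compose[of g fst "(s0, t0)" UNIV] deriv[OF \<open>s0 \<in> I\<close>]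
      by (auto simp: bounded_linear_imp_differentiable bounded_linear_fst real_differentiable_def)
    show "(\<lambda>p::real \<times> real. g (snd p)) differentiable (at (s0, t0))"
      using differentiable_compose[of g snd "(s0, t0)" UNIV] deriv[OF \<open>t0 \<in> I\<close>]
      by (auto simp: bounded_linear_imp_differentiable bounded_linear_snd real_differentiable_def)
  qed (use False in \<open>auto intro: bounded_linear_imp_differentiable bounded_linear_fst bounded_linear_snd\<close>)
  then obtain D where D: "((\<lambda>p::real \<times> real. (g (fst p) - g (snd p)) / (fst p - snd p)) has_derivative D)
      (at (s0, t0))"
    by (auto simp: differentiable_def)
  have "open {p :: real \<times> real. fst p \<noteq> snd p}"
    by (intro open_Collect_neq continuous_intros)
  then have "((\<lambda>p. divided_diff g g' (fst p) (snd p)) has_derivative D) (at (s0, t0))"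
    by (rule has_derivative_transform_within_open[OF D]) (use False in \<open>auto simp: divided_diff_def\<close>)
  then show ?thesis
    by (auto simp: differentiable_def)
qed

lemma divided_diff_sym: "divided_diff g g' s t = divided_diff g g' t s"
  by (simp add: divided_diff_def) (metis minus_diff_eq minus_divide_divide)

lemma divided_diff_pos:
  assumes "\<And>w. min s t \<le> w \<Longrightarrow> w \<le> max s t \<Longrightarrow> (g has_real_derivative g' w) (at w) \<and> g' w > 0"
  shows "divided_diff g g' s t > 0"
proof -
  have pos: "divided_diff g g' hi lo > 0" if lh: "lo < hi" "min s t = lo" "max s t = hi" for lo hi
  proof -
    obtain \<xi> where \<xi>: "lo < \<xi>" "\<xi> < hi" "g hi - g lo = (hi - lo) * g' \<xi>"
      using MVT2[of lo hi g g'] assms lh by force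
    then have "g hi - g lo > 0"
      using assms[of \<xi>] lh by simp
    then show ?thesis
      using lh by (simp add: divided_diff_def)
  qed
  consider "s = t" | "s < t" | "t < s"
    by linarith
  then show ?thesis
  proof cases
    case 1
    then show ?thesis
      using assms[of s] by (simp add: divided_diff_def)
  next
    case 2
    then show ?thesis
      using pos[of s t] divided_diff_sym[of g g' s t] by simp
  next
    case 3
    then show ?thesis
      using pos[of t s] by simp
  qed
qed

lemma theta_eq_divided_diff: "theta \<phi> s t = 1 / divided_diff (deriv \<phi>) (deriv (deriv \<phi>)) s t"
  by (simp add: theta_def divided_diff_def)

subsection \<open>Differentiation on the orthant and in the simplex chart\<close>

lemma open_pos_orthant: "open {z :: real^'n. \<forall>i. 0 < z $ i}"
proof -
  have "{z :: real^'n. \<forall>i. 0 < z $ i} = (\<Inter>i. {z. 0 < z $ i})"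
    by auto
  then show ?thesis
    by (simp add: open_INT open_halfspace_component_gt_cart)
qed

lemma differentiable_prod:
  fixes f :: "'i \<Rightarrow> 'a::real_normed_vector \<Rightarrow> real"
  assumes "\<And>i. i \<in> I \<Longrightarrow> f i differentiable (at x)"
  shows "(\<lambda>x. \<Prod>i\<in>I. f i x) differentiable (at x)"
proof -
  obtain f' where "\<And>i. i \<in> I \<Longrightarrow> (f i has_derivative f' i) (at x)"
    using assms unfolding differentiable_def by metis
  then show ?thesis
    unfolding differentiable_def by (blast intro: has_derivative_prod)
qed

lemma det_differentiable:
  fixes M :: "'a::real_normed_vector \<Rightarrow> real^'n^'n"
  assumes "\<And>i j. (\<lambda>z. M z $ i $ j) differentiable (at z0)"
  shows "(\<lambda>z. det (M z)) differentiable (at z0)"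
  unfolding det_def
  by (intro differentiable_sum finite_permutations ballI differentiable_mult differentiable_const
      differentiable_prod assms) simp

lemma deriv_along_line:
  fixes g :: "'a::real_normed_vector \<Rightarrow> real"
  assumes "(g has_derivative g') (at y)"
  shows "deriv (\<lambda>t. g (y + t *\<^sub>R w)) 0 = g' w"
proof -
  have "((\<lambda>t::real. y + t *\<^sub>R w) has_derivative (\<lambda>t. t *\<^sub>R w)) (at 0)"
    by (auto intro!: derivative_eq_intros)
  then have "((\<lambda>t. g (y + t *\<^sub>R w)) has_derivative (\<lambda>t. g' (t *\<^sub>R w))) (at 0)"
    using has_derivative_compose[of "\<lambda>t. y + t *\<^sub>R w" _ 0 UNIV g g'] assms by simp
  moreover have "(\<lambda>t. g' (t *\<^sub>R w)) = (\<lambda>t. g' w * t)"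
    using has_derivative_bounded_linear[OF assms] by (simp add: linear_simps fun_eq_iff mult.commute)
  ultimately show ?thesis
    by (intro DERIV_imp_deriv) (simp add: has_field_derivative_def)
qed

lemma pd_eq_derivative: "(g has_derivative g') (at y) \<Longrightarrow> pd g i y = g' (axis i 1)"
  unfolding pd_def by (rule deriv_along_line)

lemma eventually_line_in_open:
  fixes x v :: "'a::real_normed_vector"
  assumes "open U" "x \<in> U"
  shows "eventually (\<lambda>t :: real. x + t *\<^sub>R v \<in> U) (nhds 0)"
proof -
  have "continuous_on UNIV (\<lambda>t :: real. x + t *\<^sub>R v)"
    by (intro continuous_intros)
  from open_vimage[OF assms(1) this] have "open {t :: real. x + t *\<^sub>R v \<in> U}"
    by (simp add: vimage_def)
  then show ?thesis
    using assms(2) unfolding eventually_nhds by force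
qed

lemma lift_add_axis:
  assumes "j \<noteq> k"
  shows "lift k (y + s *\<^sub>R axis j 1) = lift k y + s *\<^sub>R (axis j 1 - axis k (1 :: real))"
proof -
  have "(\<Sum>l\<in>UNIV - {k}. (y + s *\<^sub>R axis j 1) $ l) = (\<Sum>l\<in>UNIV - {k}. y $ l + (if l = j then s else 0))"
    by (intro sum.cong) (auto simp: axis_def)
  also have "\<dots> = (\<Sum>l\<in>UNIV - {k}. y $ l) + s"
    using assms by (simp add: sum.distrib)
  finally show ?thesis
    using assms by (simp add: lift_def vec_eq_iff axis_def)
qed

lemma lift_eq_self: "(\<Sum>i\<in>UNIV. x $ i) = (1 :: real) \<Longrightarrow> lift k x = x"
  by (simp add: lift_def vec_eq_iff sum_UNIV_Diff_singleton)

lemma pd_comp_lift: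
  assumes "i \<noteq> k" "(g has_derivative g') (at (lift k y))"
  shows "pd (\<lambda>y. g (lift k y)) i y = g' (axis i 1 - axis k 1)"
  unfolding pd_def lift_add_axis[OF assms(1)] using assms(2) by (rule deriv_along_line)

lemma pd_comp_lift_eq_diff:
  assumes "i \<noteq> k" "f differentiable (at (lift k y))"
  shows "pd (\<lambda>y. f (lift k y)) i y = pd f i (lift k y) - pd f k (lift k y)"
proof -
  obtain f' where f': "(f has_derivative f') (at (lift k y))"
    using assms(2) by (auto simp: differentiable_def)
  then have "linear f'"
    by (rule has_derivative_linear)
  with f' show ?thesis
    by (simp add: pd_comp_lift[OF assms(1) f'] pd_eq_derivative linear_diff)
qed

lemma C2_on_pos_orthant_differentiable:
  assumes "C2_on {z. \<forall>m. z $ m > 0} f" "\<forall>m. 0 < z $ m"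
  shows "f differentiable (at z)" "pd f j differentiable (at z)"
proof -
  have "f differentiable_on {z. \<forall>m. 0 < z $ m}" "pd f j differentiable_on {z. \<forall>m. 0 < z $ m}"
    using assms(1) by (simp_all add: C2_on_def)
  then show "f differentiable (at z)" "pd f j differentiable (at z)"
    using assms(2) by (auto simp: differentiable_on_eq_differentiable_at[OF open_pos_orthant])
qed

lemma sum_chart_derivatives_eq_divergence:
  fixes V :: "'n \<Rightarrow> real^'n \<Rightarrow> real"
  assumes deriv: "\<And>i. (V i has_derivative V' i) (at x)"
    and conserved: "\<And>z. (\<Sum>i\<in>UNIV. V i z) = 0"
  shows "(\<Sum>i\<in>UNIV - {k}. V' i (axis i 1 - axis k 1)) = (\<Sum>i\<in>UNIV. pd (V i) i x)"
proof -
  have "((\<lambda>z. \<Sum>i\<in>UNIV. V i z) has_derivative (\<lambda>h. \<Sum>i\<in>UNIV. V' i h)) (at x)"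
    by (intro has_derivative_sum deriv)
  then have "((\<lambda>z. 0) has_derivative (\<lambda>h. \<Sum>i\<in>UNIV. V' i h)) (at x)"
    by (simp add: conserved)
  then have "(\<lambda>h. \<Sum>i\<in>UNIV. V' i h) = (\<lambda>h. 0)"
    using has_derivative_unique has_derivative_const by blast
  then have "(\<Sum>i\<in>UNIV - {k}. V' i (axis k 1)) = - V' k (axis k 1)"
    by (simp add: sum_UNIV_Diff_singleton fun_eq_iff)
  moreover have "linear (V' i)" for i
    using deriv by (rule has_derivative_linear)
  ultimately show ?thesis
    by (simp add: linear_diff sum_subtractf sum_UNIV_Diff_singleton pd_eq_derivative[OF deriv])
qed

subsection \<open>The Onsager response matrix\<close>

locale onsager =
  fixes Q :: "real^'n^'n" and xs :: "real^'n" and \<phi> :: "real \<Rightarrow> real"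
  assumes Q_offdiag: "\<forall>i j. i \<noteq> j \<longrightarrow> Q $ i $ j \<ge> 0"
    and Q_conn: "\<forall>i j. (i, j) \<in> ({(a, b). a \<noteq> b \<and> Q $ a $ b > 0} \<union> {(a, b). a \<noteq> b \<and> Q $ b $ a > 0})\<^sup>*"
    and xs_pos: "\<forall>i. xs $ i > 0"
    and detailed_balance: "\<forall>i j. Q $ i $ j * xs $ i = Q $ j $ i * xs $ j"
    and \<phi>_smooth: "smooth_pos \<phi>"
    and \<phi>_conv: "\<forall>t>0. deriv (deriv \<phi>) t > 0"
begin

abbreviation K :: "real^'n \<Rightarrow> real^'n^'n" where
  "K \<equiv> Kmat Q xs \<phi>"

lemma deriv_\<phi>_has_real_derivative: "t > 0 \<Longrightarrow> (deriv \<phi> has_real_derivative deriv (deriv \<phi>) t) (at t)"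
  using \<phi>_smooth[unfolded smooth_pos_def, rule_format, where k = 1 and t = t]
  by (simp add: DERIV_deriv_iff_real_differentiable)

lemma deriv2_\<phi>_differentiable: "t > 0 \<Longrightarrow> deriv (deriv \<phi>) differentiable (at t)"
  using \<phi>_smooth[unfolded smooth_pos_def, rule_format, where k = 2 and t = t] by (simp add: numeral_2_eq_2)

lemma theta_pos: "s > 0 \<Longrightarrow> t > 0 \<Longrightarrow> theta \<phi> s t > 0"
  unfolding theta_eq_divided_diff
  by (intro divide_pos_pos divided_diff_pos) (auto simp: deriv_\<phi>_has_real_derivative \<phi>_conv)

lemma theta_differentiable:
  assumes "s > 0" "t > 0"
  shows "(\<lambda>p. theta \<phi> (fst p) (snd p)) differentiable (at (s, t))"
proof -
  have "(\<lambda>p. divided_diff (deriv \<phi>) (deriv (deriv \<phi>)) (fst p) (snd p)) differentiable (at (s, t))"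
    using assms by (intro divided_diff_differentiable[of "{0<..}"])
      (auto simp: deriv_\<phi>_has_real_derivative deriv2_\<phi>_differentiable)
  moreover have "divided_diff (deriv \<phi>) (deriv (deriv \<phi>)) s t \<noteq> 0"
    using theta_pos[OF assms] by (auto simp: theta_eq_divided_diff)
  ultimately show ?thesis
    unfolding theta_eq_divided_diff by (auto intro: differentiable_divide)
qed

definition edge_weight :: "real^'n \<Rightarrow> 'n \<Rightarrow> 'n \<Rightarrow> real" where
  "edge_weight z i j = (if i = j then 0 else Q $ i $ j * xs $ i * theta \<phi> (z $ i / xs $ i) (z $ j / xs $ j))"

lemma edge_weight_sym: "edge_weight z i j = edge_weight z j i"
  using detailed_balance by (simp add: edge_weight_def theta_eq_divided_diff divided_diff_sym)

lemma edge_weight_nonneg: "\<forall>m. 0 < z $ m \<Longrightarrow> edge_weight z i j \<ge> 0"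
  using Q_offdiag xs_pos theta_pos[of "z $ i / xs $ i" "z $ j / xs $ j"]
  by (auto simp: edge_weight_def less_imp_le intro!: mult_nonneg_nonneg)

lemma edge_weight_pos: "\<forall>m. 0 < z $ m \<Longrightarrow> i \<noteq> j \<Longrightarrow> Q $ i $ j > 0 \<Longrightarrow> edge_weight z i j > 0"
  using xs_pos theta_pos[of "z $ i / xs $ i" "z $ j / xs $ j"] by (simp add: edge_weight_def)

lemma Kmat_eq: "K z $ i $ j = (if i = j then (\<Sum>k\<in>UNIV. edge_weight z i k) else - edge_weight z i j)"
proof -
  have "(\<Sum>k\<in>UNIV. edge_weight z i k) = (\<Sum>k\<in>UNIV - {i}. edge_weight z i k)"
    by (rule sum.mono_neutral_right) (auto simp: edge_weight_def)
  also have "\<dots> = (\<Sum>k\<in>UNIV - {i}. Q $ i $ k * xs $ i * theta \<phi> (z $ i / xs $ i) (z $ k / xs $ k))"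
    by (intro sum.cong) (auto simp: edge_weight_def)
  finally have diag: "(\<Sum>k\<in>UNIV. edge_weight z i k)
      = (\<Sum>k\<in>UNIV - {i}. Q $ i $ k * xs $ i * theta \<phi> (z $ i / xs $ i) (z $ k / xs $ k))" .
  show ?thesis
  proof (cases "i = j")
    case True
    with diag show ?thesis
      by (simp add: Kmat_def)
  qed (simp add: Kmat_def edge_weight_def)
qed

lemma Kmat_mult_vec: "(K z *v v) $ i = (\<Sum>j\<in>UNIV. edge_weight z i j * (v $ i - v $ j))"
proof -
  have "(K z *v v) $ i = (\<Sum>j\<in>UNIV. K z $ i $ j * v $ j)"
    by (simp add: matrix_vector_mult_def)
  also have "\<dots> = (\<Sum>j\<in>UNIV. (if i = j then (\<Sum>k\<in>UNIV. edge_weight z i k) else 0) * v $ j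
      - edge_weight z i j * v $ j)"
    by (intro sum.cong) (auto simp: Kmat_eq edge_weight_def)
  also have "\<dots> = (\<Sum>j\<in>UNIV. edge_weight z i j * (v $ i - v $ j))"
    by (simp add: sum_subtractf right_diff_distrib sum_distrib_right sum_delta_mult)
  finally show ?thesis .
qed

lemma laplacian_matrix_K: "laplacian_matrix (K z)"
proof
  show "K z $ i $ j = K z $ j $ i" for i j
    by (simp add: Kmat_eq edge_weight_sym)
  show "(\<Sum>j\<in>UNIV. K z $ i $ j) = 0" for i
    using Kmat_mult_vec[of z 1 i] by (simp add: matrix_vector_mult_def)
qed

lemma quadratic_form_K:
  "2 * (v \<bullet> (K z *v v)) = (\<Sum>i\<in>UNIV. \<Sum>j\<in>UNIV. edge_weight z i j * (v $ i - v $ j)\<^sup>2)"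
proof -
  have "v \<bullet> (K z *v v) = (\<Sum>i\<in>UNIV. v $ i * (\<Sum>j\<in>UNIV. edge_weight z i j * (v $ i - v $ j)))"
    by (simp add: inner_vec_def Kmat_mult_vec)
  also have "\<dots> = (\<Sum>i\<in>UNIV. \<Sum>j\<in>UNIV. edge_weight z i j * (v $ i * (v $ i - v $ j)))"
    by (simp add: sum_distrib_left mult.left_commute)
  moreover have "(\<Sum>i\<in>UNIV. \<Sum>j\<in>UNIV. edge_weight z i j * (v $ i * (v $ i - v $ j)))
      = (\<Sum>i\<in>UNIV. \<Sum>j\<in>UNIV. edge_weight z i j * (v $ j * (v $ j - v $ i)))"
    by (subst sum.swap) (simp add: edge_weight_sym)
  ultimately have "2 * (v \<bullet> (K z *v v))
      = (\<Sum>i\<in>UNIV. \<Sum>j\<in>UNIV. edge_weight z i j * (v $ i * (v $ i - v $ j)))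
        + (\<Sum>i\<in>UNIV. \<Sum>j\<in>UNIV. edge_weight z i j * (v $ j * (v $ j - v $ i)))"
    by linarith
  also have "\<dots> = (\<Sum>i\<in>UNIV. \<Sum>j\<in>UNIV. edge_weight z i j * (v $ i - v $ j)\<^sup>2)"
    by (simp add: sum.distrib[symmetric] power2_eq_square algebra_simps)
  finally show ?thesis .
qed

lemma Q_pos_sym: "Q $ b $ a > 0 \<Longrightarrow> Q $ a $ b > 0"
proof -
  assume "Q $ b $ a > 0"
  then have "0 < Q $ b $ a * xs $ b"
    using xs_pos by simp
  then have "0 < Q $ a $ b * xs $ a"
    using detailed_balance by simp
  then show ?thesis
    using xs_pos[rule_format, of a] by (simp add: zero_less_mult_iff)
qed

lemma quadratic_form_K_eq_0_imp_edge_eq: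
  assumes z: "\<forall>m. 0 < z $ m" and "v \<bullet> (K z *v v) = 0" "a \<noteq> b" "Q $ a $ b > 0"
  shows "v $ a = v $ b"
proof -
  have terms_nonneg: "edge_weight z i j * (v $ i - v $ j)\<^sup>2 \<ge> 0" for i j
    using edge_weight_nonneg[OF z] by simp
  have "(\<Sum>i\<in>UNIV. \<Sum>j\<in>UNIV. edge_weight z i j * (v $ i - v $ j)\<^sup>2) = 0"
    using quadratic_form_K[of v z] assms(2) by simp
  then have "\<forall>i\<in>UNIV. (\<Sum>j\<in>UNIV. edge_weight z i j * (v $ i - v $ j)\<^sup>2) = 0"
    by (subst (asm) sum_nonneg_eq_0_iff) (auto intro: sum_nonneg terms_nonneg)
  then have "edge_weight z a b * (v $ a - v $ b)\<^sup>2 = 0"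
    using terms_nonneg by (simp add: sum_nonneg_eq_0_iff)
  with edge_weight_pos[OF z assms(3,4)] show ?thesis
    by simp
qed

lemma psd_laplacian_K:
  assumes z: "\<forall>m. 0 < z $ m"
  shows "psd_laplacian (K z)"
proof -
  interpret laplacian_matrix "K z"
    by (rule laplacian_matrix_K)
  show ?thesis
  proof
    fix v :: "real^'n"
    have "0 \<le> 2 * (v \<bullet> (K z *v v))"
      unfolding quadratic_form_K using edge_weight_nonneg[OF z] by (intro sum_nonneg) simp
    then show "0 \<le> v \<bullet> (K z *v v)"
      by simp
    fix i j
    assume "v \<bullet> (K z *v v) = 0"
    have "(i, j) \<in> ({(a, b). a \<noteq> b \<and> Q $ a $ b > 0} \<union> {(a, b). a \<noteq> b \<and> Q $ b $ a > 0})\<^sup>*"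
      using Q_conn by blast
    then show "v $ i = v $ j"
    proof (induction rule: rtrancl_induct)
      case (step b c)
      then have "b \<noteq> c" "Q $ b $ c > 0"
        using Q_pos_sym by auto
      with step quadratic_form_K_eq_0_imp_edge_eq[OF z \<open>v \<bullet> (K z *v v) = 0\<close>] show ?case
        by simp
    qed simp
  qed
qed

lemma theta_comp_differentiable:
  assumes z0: "\<forall>m. 0 < z0 $ m"
  shows "(\<lambda>z. theta \<phi> (z $ i / xs $ i) (z $ j / xs $ j)) differentiable (at z0)"
proof -
  let ?g = "\<lambda>z :: real^'n. (z $ i / xs $ i, z $ j / xs $ j)"
  have "?g differentiable (at z0)"
    by (intro bounded_linear_imp_differentiable bounded_linear_Pair
        bounded_linear_compose[OF bounded_linear_divide bounded_linear_vec_nth])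
  moreover have "(\<lambda>p. theta \<phi> (fst p) (snd p)) differentiable (at (?g z0))"
    using z0 xs_pos by (simp add: theta_differentiable)
  ultimately show ?thesis
    using differentiable_compose[of "\<lambda>p. theta \<phi> (fst p) (snd p)" ?g z0] by simp
qed

lemma edge_weight_differentiable:
  assumes "\<forall>m. 0 < z0 $ m"
  shows "(\<lambda>z. edge_weight z i j) differentiable (at z0)"
proof (cases "i = j")
  case False
  then show ?thesis
    unfolding edge_weight_def
    by (simp add: theta_comp_differentiable assms)
qed (simp add: edge_weight_def)

lemma Kmat_differentiable:
  assumes "\<forall>m. 0 < z0 $ m"
  shows "(\<lambda>z. K z $ i $ j) differentiable (at z0)"
  by (cases "i = j") (simp_all add: Kmat_eq edge_weight_differentiable assms)

lemma detg_eq: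
  assumes "\<forall>m. 0 < z $ m"
  shows "detg (K z) = real CARD('n) / (\<Sum>j\<in>UNIV. det (K z + diag_unit j))"
  using psd_laplacian.pos_eig_prod_eq[OF psd_laplacian_K[OF assms]] by (simp add: detg_def)

lemma sqrt_detg_differentiable:
  assumes z0: "\<forall>m. 0 < z0 $ m"
  shows "(\<lambda>z. sqrt (detg (K z))) differentiable (at z0)"
proof -
  define D where "D z = (\<Sum>j\<in>UNIV. det (K z + diag_unit j))" for z
  have "D z0 > 0"
    using psd_laplacian.det_plus_diag_unit_pos[OF psd_laplacian_K[OF z0]] by (simp add: D_def sum_pos)
  moreover have "D differentiable (at z0)"
    unfolding D_def
    by (intro differentiable_sum ballI det_differentiable) (simp_all add: Kmat_differentiable z0)
  ultimately have "(\<lambda>z. real CARD('n) / D z) differentiable (at z0)"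
    and "sqrt differentiable (at (real CARD('n) / D z0))"
    using DERIV_real_sqrt[of "real CARD('n) / D z0"]
    by (auto intro: differentiable_divide simp: real_differentiable_def)
  then have "(\<lambda>z. sqrt (real CARD('n) / D z)) differentiable (at z0)"
    using differentiable_compose[of sqrt "\<lambda>z. real CARD('n) / D z" z0 UNIV] by simp
  then obtain D' where D': "((\<lambda>z. sqrt (real CARD('n) / D z)) has_derivative D') (at z0)"
    by (auto simp: differentiable_def)
  have "((\<lambda>z. sqrt (detg (K z))) has_derivative D') (at z0)"
    by (rule has_derivative_transform_within_open[OF D' open_pos_orthant])
      (use z0 in \<open>auto simp: detg_eq D_def\<close>)
  then show ?thesis
    by (auto simp: differentiable_def)
qed

lemma pd_chart_flux_term:
  assumes f: "\<And>z. \<forall>m. 0 < z $ m \<Longrightarrow> f differentiable (at z)"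
    and x: "\<forall>m. 0 < x $ m" "(\<Sum>m\<in>UNIV. x $ m) = 1"
    and ij: "i \<noteq> l" "j \<noteq> l"
    and T': "((\<lambda>z. sqrt (detg (K z)) * K z $ i $ j * (pd f j z - pd f l z)) has_derivative T') (at x)"
  shows "pd (\<lambda>y. sqrt (detg (K (lift l y))) * gup l (K (lift l y)) $ i $ j * pd (\<lambda>y. f (lift l y)) j y) i x
       = T' (axis i 1 - axis l 1)"
proof -
  let ?T = "\<lambda>z. sqrt (detg (K z)) * K z $ i $ j * (pd f j z - pd f l z)"
  let ?L = "\<lambda>y. sqrt (detg (K (lift l y))) * gup l (K (lift l y)) $ i $ j * pd (\<lambda>y. f (lift l y)) j y"
  have local_eq: "?L y = ?T (lift l y)" if "\<forall>m. 0 < lift l y $ m" for y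
    using psd_laplacian.gup_eq[OF psd_laplacian_K[OF that] ij] pd_comp_lift_eq_diff[OF ij(2) f[OF that]]
    by simp
  have "eventually (\<lambda>t. x + t *\<^sub>R (axis i 1 - axis l 1) \<in> {z. \<forall>m. 0 < z $ m}) (nhds 0)"
    using x by (intro eventually_line_in_open open_pos_orthant) simp
  then have "eventually (\<lambda>t. ?L (x + t *\<^sub>R axis i 1) = ?T (lift l (x + t *\<^sub>R axis i 1))) (nhds 0)"
  proof (rule eventually_mono)
    fix t
    assume "x + t *\<^sub>R (axis i 1 - axis l 1) \<in> {z. \<forall>m. 0 < z $ m}"
    then have "\<forall>m. 0 < lift l (x + t *\<^sub>R axis i 1) $ m"
      by (simp add: lift_add_axis[OF ij(1)] lift_eq_self[OF x(2)])
    then show "?L (x + t *\<^sub>R axis i 1) = ?T (lift l (x + t *\<^sub>R axis i 1))"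
      by (rule local_eq)
  qed
  then have "pd ?L i x = pd (\<lambda>y. ?T (lift l y)) i x"
    unfolding pd_def by (rule deriv_cong_ev) simp
  also have "\<dots> = T' (axis i 1 - axis l 1)"
    using T' lift_eq_self[OF x(2)] by (intro pd_comp_lift ij) simp
  finally show ?thesis .
qed

lemma laplace_beltrami_chart_eq_divergence:
  assumes f: "C2_on {z. \<forall>m. z $ m > 0} f"
    and x: "\<forall>m. 0 < x $ m" "(\<Sum>m\<in>UNIV. x $ m) = 1"
  shows "(\<Sum>i\<in>UNIV - {l}. \<Sum>j\<in>UNIV - {l}.
           pd (\<lambda>y. sqrt (detg (K (lift l y))) * gup l (K (lift l y)) $ i $ j * pd (\<lambda>y. f (lift l y)) j y) i x)
       = (\<Sum>k\<in>UNIV. pd (\<lambda>z. sqrt (detg (K z)) * (K z *v egrad f z) $ k) k x)"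
proof -
  note f_diff = C2_on_pos_orthant_differentiable[OF f]
  define T where "T i j z = sqrt (detg (K z)) * K z $ i $ j * (pd f j z - pd f l z)" for i j z
  have "T i j differentiable (at x)" for i j
    unfolding T_def using x f_diff
    by (intro differentiable_mult differentiable_diff sqrt_detg_differentiable Kmat_differentiable) auto
  then obtain T' where T': "\<And>i j. (T i j has_derivative T' i j) (at x)"
    unfolding differentiable_def by metis
  have flux: "(\<lambda>z. sqrt (detg (K z)) * (K z *v egrad f z) $ i) = (\<lambda>z. \<Sum>j\<in>UNIV - {l}. T i j z)" for i
  proof
    fix z
    have "(K z *v egrad f z) $ i = (\<Sum>j\<in>UNIV - {l}. K z $ i $ j * (pd f j z - pd f l z))"
      using laplacian_matrix.mult_vec_shift[OF laplacian_matrix_K[of z], where k = l and w = "egrad f z"]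
      by (simp add: egrad_def)
    then show "sqrt (detg (K z)) * (K z *v egrad f z) $ i = (\<Sum>j\<in>UNIV - {l}. T i j z)"
      by (simp add: T_def sum_distrib_left mult.assoc)
  qed
  have conserved: "(\<Sum>i\<in>UNIV. \<Sum>j\<in>UNIV - {l}. T i j z) = 0" for z
  proof -
    have "(\<Sum>i\<in>UNIV. \<Sum>j\<in>UNIV - {l}. T i j z) = sqrt (detg (K z)) * (\<Sum>i\<in>UNIV. (K z *v egrad f z) $ i)"
      using fun_cong[OF flux, where x = z] by (simp add: sum_distrib_left)
    then show ?thesis
      by (simp add: laplacian_matrix.sum_mult_vec[OF laplacian_matrix_K])
  qed
  have "(\<Sum>i\<in>UNIV - {l}. \<Sum>j\<in>UNIV - {l}.
           pd (\<lambda>y. sqrt (detg (K (lift l y))) * gup l (K (lift l y)) $ i $ j * pd (\<lambda>y. f (lift l y)) j y) i x)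
      = (\<Sum>i\<in>UNIV - {l}. \<Sum>j\<in>UNIV - {l}. T' i j (axis i 1 - axis l 1))"
    using T'[unfolded T_def] x f_diff by (intro sum.cong refl pd_chart_flux_term) auto
  also have "\<dots> = (\<Sum>k\<in>UNIV. pd (\<lambda>z. \<Sum>j\<in>UNIV - {l}. T k j z) k x)"
    using T' conserved by (intro sum_chart_derivatives_eq_divergence has_derivative_sum)
  finally show ?thesis
    by (simp add: flux)
qed

lemma dirichlet_energy_chart:
  assumes f: "C2_on {z. \<forall>m. z $ m > 0} f"
    and x: "\<forall>m. 0 < x $ m" "(\<Sum>m\<in>UNIV. x $ m) = 1"
  shows "(\<Sum>i\<in>UNIV - {l}. \<Sum>j\<in>UNIV - {l}.
           gup l (K x) $ i $ j * pd (\<lambda>y. f (lift l y)) i x * pd (\<lambda>y. f (lift l y)) j x)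
       = egrad f x \<bullet> (K x *v egrad f x)"
proof -
  have "f differentiable (at x)"
    using f x(1) by (rule C2_on_pos_orthant_differentiable)
  then have "pd (\<lambda>y. f (lift l y)) i x = egrad f x $ i - egrad f x $ l" if "i \<noteq> l" for i
    using pd_comp_lift_eq_diff[OF that] lift_eq_self[OF x(2)] by (simp add: egrad_def)
  then show ?thesis
    using psd_laplacian.gup_eq[OF psd_laplacian_K[OF x(1)]]
      laplacian_matrix.quadratic_form_shift[OF laplacian_matrix_K[of x], where k = l and w = "egrad f x"]
    by (simp add: mult_ac)
qed

end

theorem lemma2p3:
  fixes Q :: "real^'n^'n" and xs :: "real^'n" and \<phi> :: "real \<Rightarrow> real"
    and f :: "real^'n \<Rightarrow> real" and dl :: 'n and x :: "real^'n"
  defines "K \<equiv> Kmat Q xs \<phi>"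
    and "G \<equiv> (\<lambda>z. detg (Kmat Q xs \<phi> z))"
    and "F \<equiv> (\<lambda>y. f (lift dl y))"
  assumes d2: "CARD('n) \<ge> 2"
    and Q_offdiag: "\<forall>i j. i \<noteq> j \<longrightarrow> Q$i$j \<ge> 0"
    and Q_rows: "\<forall>i. (\<Sum>j\<in>UNIV. Q$i$j) = 0"
    and Q_conn: "\<forall>i j. (i, j) \<in> ({(a, b). a \<noteq> b \<and> Q$a$b > 0} \<union> {(a, b). a \<noteq> b \<and> Q$b$a > 0})\<^sup>*"
    and xs_pos: "\<forall>i. xs$i > 0"
    and xs_stat: "transpose Q *v xs = 0"
    and xs_sum: "(\<Sum>i\<in>UNIV. xs$i) = 1"
    and db: "\<forall>i j. Q$i$j * xs$i = Q$j$i * xs$j"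
    and \<phi>_smooth: "smooth_pos \<phi>"
    and \<phi>_conv: "\<forall>t>0. deriv (deriv \<phi>) t > 0"
    and f_C2: "C2_on {z. \<forall>i. z$i > 0} f"
    and x_simplex: "\<forall>i. 0 < x$i \<and> x$i < 1" "(\<Sum>i\<in>UNIV. x$i) = 1"
  shows "(1 / sqrt (G x) *
           (\<Sum>i\<in>UNIV - {dl}. \<Sum>j\<in>UNIV - {dl}.
              pd (\<lambda>y. sqrt (G (lift dl y)) * gup dl (K (lift dl y)) $ i $ j * pd F j y) i x)
         = 1 / sqrt (G x) * (\<Sum>k\<in>UNIV. pd (\<lambda>z. sqrt (G z) * (K z *v egrad f z) $ k) k x))
       \<and> ((\<Sum>i\<in>UNIV - {dl}. \<Sum>j\<in>UNIV - {dl}. gup dl (K x) $ i $ j * pd F i x * pd F j x)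
         = egrad f x \<bullet> (K x *v egrad f x))"
proof -
  interpret onsager Q xs \<phi>
    using Q_offdiag Q_conn xs_pos db \<phi>_smooth \<phi>_conv by unfold_locales
  have x_pos: "\<forall>m. 0 < x $ m"
    using x_simplex(1) by simp
  show ?thesis
    unfolding K_def G_def F_def
    using laplace_beltrami_chart_eq_divergence[OF f_C2 x_pos x_simplex(2)]
      dirichlet_energy_chart[OF f_C2 x_pos x_simplex(2)]
    by simp
qed

end
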